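(* Let $d \in \{2,3\}$, let $W \colon \mathbb{R}^{d \times d} \to \mathbb{R}_\infty$ be isotropic, and let $\Phi \colon \mathbb{R}^{d} \to \mathbb{R}_\infty$ be given by $\Phi(\nu) = W(\operatorname{diag}(\nu))$ for $\nu\in\mathbb{R}^d$. Then the following statements are equivalent: (i) $W$ is lower semicontinuous polyconvex; (ii) there exists a lower semicontinuous convex function $g \colon \mathbb{R}^{k_d} \to \mathbb{R}_\infty$ such that $W(\operatorname{diag}(\nu)) = g(m(\nu))$ for all $\nu \in \mathbb{R}^{d}$; (iii) $\Phi$ is lower semicontinuous polyconvex (in the sense of functions on $\mathbb{R}^d$).
   Context: $\mathbb{R}_\infty := \mathbb{R}\cup\{\infty\}$. $\mathrm{SO}(d)$ is the special orthogonal group. $\operatorname{diag}(\nu)$ is the diagonal $d\times d$ matrix with diagonal entries $\nu_1,\dots,\nu_d$. Isotropic: $W \colon \mathbb{R}^{d \times d} \to \mathbb{R}_\infty$ is isotropic if $W(F) = W(R_1 F R_2)$ for all $F \in \mathbb{R}^{d\times d}$ and $R_1,R_2\in \mathrm{SO}(d)$. Polyconvexity on matrices: let $\mathcal{M}(F)\in\mathbb{R}^{K_d}$, $K_d=\sum_{i=1}^d\binom{d}{i}^2$, be the vector of all minors of $F\in\mathbb{R}^{d\times d}$; that is, $\mathcal{M}(F)=(F,\det F)\in\mathbb{R}^5$ for $d=2$ and $\mathcal{M}(F)=(F,\operatorname{adj}(F)^\top,\det F)\in\mathbb{R}^{19}$ for $d=3$, where $\operatorname{adj}(F)$ is the adjugate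 matrix. $W \colon \mathbb{R}^{d \times d} \to \mathbb{R}_\infty$ is lower semicontinuous polyconvex if there is a lower semicontinuous convex function $G\colon\mathbb{R}^{K_d}\to\mathbb{R}_\infty$ with $W(F)=G(\mathcal{M}(F))$ for all $F\in\mathbb{R}^{d\times d}$. Polyconvexity on vectors: $k_d=2^d-1$, and $m\colon\mathbb{R}^d\to\mathbb{R}^{k_d}$ is $m(\nu)=(\nu_1,\nu_2,\nu_1\nu_2)$ for $d=2$ and $m(\nu)=(\nu_1,\nu_2,\nu_3,\nu_2\nu_3,\nu_1\nu_3,\nu_1\nu_2,\nu_1\nu_2\nu_3)$ for $d=3$. $\Phi\colon\mathbb{R}^d\to\mathbb{R}_\infty$ is lower semicontinuous polyconvex if there is a lower semicontinuous convex function $g\colon\mathbb{R}^{k_d}\to\mathbb{R}_\infty$ with $\Phi(\nu)=g(m(\nu))$ for all $\nu\in\mathbb{R}^d$. *)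

theory Defs
  imports "HOL-Analysis.Analysis"
begin

text \<open>
  Functions into \<open>\<real> \<union> {\<infinity>}\<close> are \<^typ>\<open>ereal\<close>-valued functions that omit the value \<open>-\<infinity>\<close>;
  the constant \<open>\<infinity>\<close> is allowed.
\<close>

definition into_Rinf :: "('a \<Rightarrow> ereal) \<Rightarrow> bool" where
  "into_Rinf f \<longleftrightarrow> (\<forall>x. f x \<noteq> -\<infinity>)"

definition lower_semicontinuous :: "('a::topological_space \<Rightarrow> ereal) \<Rightarrow> bool" where
  "lower_semicontinuous f \<longleftrightarrow> (\<forall>x. f x \<le> Liminf (at x) f)"

text \<open>For \<^typ>\<open>ereal\<close> one has \<open>0 * \<infinity> = 0\<close>, so the endpoints \<open>t = 0\<close> and \<open>t = 1\<close> impose nothing.\<close>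

definition convex_ereal :: "('a::real_vector \<Rightarrow> ereal) \<Rightarrow> bool" where
  "convex_ereal f \<longleftrightarrow> (\<forall>x y. \<forall>t\<in>{0..1}.
     f ((1 - t) *\<^sub>R x + t *\<^sub>R y) \<le> ereal (1 - t) * f x + ereal t * f y)"

definition lsc_convex :: "('a::euclidean_space \<Rightarrow> ereal) \<Rightarrow> bool" where
  "lsc_convex g \<longleftrightarrow> into_Rinf g \<and> lower_semicontinuous g \<and> convex_ereal g"

definition diag :: "real^'n \<Rightarrow> real^'n^'n" where
  "diag \<nu> = (\<chi> i j. if i = j then \<nu> $ i else 0)"

definition isotropic :: "(real^'n^'n \<Rightarrow> ereal) \<Rightarrow> bool" where
  "isotropic W \<longleftrightarrow> (\<forall>F R\<^sub>1 R\<^sub>2. rotation_matrix R\<^sub>1 \<longrightarrow> rotation_matrix R\<^sub>2 \<longrightarrow>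
     W F = W (R\<^sub>1 ** F ** R\<^sub>2))"

text \<open>
  Entry \<open>(i, j)\<close> of the adjugate is the signed minor of \<open>F\<close> with row \<open>j\<close> and column \<open>i\<close> deleted;
  it is written as the determinant of \<open>F\<close> with that row and column replaced by unit vectors,
  which includes the sign and avoids submatrices.
\<close>

definition adjugate :: "real^'n^'n \<Rightarrow> real^'n^'n" where
  "adjugate F = (\<chi> i j. det (\<chi> k l.
     if k = j \<and> l = i then 1 else if k = j \<or> l = i then 0 else F $ k $ l))"

lemma adjugate_3:
  fixes F :: "real^3^3"
  shows "adjugate F = vector [
    vector [F$2$2 * F$3$3 - F$2$3 * F$3$2, F$1$3 * F$3$2 - F$1$2 * F$3$3, F$1$2 * F$2$3 - F$1$3 * F$2$2],
    vector [F$2$3 * F$3$1 - F$2$1 * F$3$3, F$1$1 * F$3$3 - F$1$3 * F$3$1, F$1$3 * F$2$1 - F$1$1 * F$2$3],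
    vector [F$2$1 * F$3$2 - F$2$2 * F$3$1, F$1$2 * F$3$1 - F$1$1 * F$3$2, F$1$1 * F$2$2 - F$1$2 * F$2$1]]"
  by (simp add: vec_eq_iff forall_3 adjugate_def det_3)

text \<open>
  The spaces \<open>\<real>\<^sup>5\<close>, \<open>\<real>\<^sup>1\<^sup>9\<close>, \<open>\<real>\<^sup>3\<close>, \<open>\<real>\<^sup>7\<close> of minors are represented by product Euclidean spaces with
  the components grouped in blocks; see the dimension counts below.
\<close>

definition minors2 :: "real^2^2 \<Rightarrow> (real^2^2) \<times> real" where
  "minors2 F = (F, det F)"

definition minors3 :: "real^3^3 \<Rightarrow> (real^3^3) \<times> (real^3^3) \<times> real" where
  "minors3 F = (F, transpose (adjugate F), det F)"

definition m2 :: "real^2 \<Rightarrow> (real^2) \<times> real" where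
  "m2 \<nu> = (\<nu>, \<nu>$1 * \<nu>$2)"

definition m3 :: "real^3 \<Rightarrow> (real^3) \<times> (real^3) \<times> real" where
  "m3 \<nu> = (\<nu>, vector [\<nu>$2 * \<nu>$3, \<nu>$1 * \<nu>$3, \<nu>$1 * \<nu>$2], \<nu>$1 * \<nu>$2 * \<nu>$3)"

lemma DIM_minors:
  "DIM((real^2^2) \<times> real) = (\<Sum>i=1..2. (2 choose i)\<^sup>2)"
  "DIM((real^3^3) \<times> (real^3^3) \<times> real) = (\<Sum>i=1..3. (3 choose i)\<^sup>2)"
  "DIM((real^2) \<times> real) = 2 ^ 2 - 1"
  "DIM((real^3) \<times> (real^3) \<times> real) = 2 ^ 3 - 1"
  by (simp_all add: numeral_eq_Suc)

text \<open>
  The notion of polyconvexity relative to a map \<open>\<mu>\<close> of minors: on matrices \<open>\<mu>\<close> is \<^const>\<open>minors2\<close>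
  or \<^const>\<open>minors3\<close>, on vectors it is \<^const>\<open>m2\<close> or \<^const>\<open>m3\<close>.
\<close>

definition lsc_polyconvex :: "('a \<Rightarrow> 'b::euclidean_space) \<Rightarrow> ('a \<Rightarrow> ereal) \<Rightarrow> bool" where
  "lsc_polyconvex \<mu> f \<longleftrightarrow> (\<exists>g. lsc_convex g \<and> (\<forall>x. f x = g (\<mu> x)))"

end

theory Submission
  imports Defs
begin

text \<open>
  Every \<open>F\<close> can be written as \<open>P diag \<nu> Q\<^sup>T\<close> with rotations \<open>P, Q\<close>; such \<open>\<nu>\<close> are the signed
  singular values of \<open>F\<close>. Let \<open>g\<close> represent \<open>\<Phi>\<close>, and let \<open>\<pi>\<close> keep only the diagonals of \<open>F\<close> and
  \<open>cof F\<close>, and \<open>det F\<close>. Rotations act linearly on the vector of minors, so the supremum of \<open>g \<circ> \<pi>\<close>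
  over these actions is lower semicontinuous and convex. It represents \<open>W\<close> as soon as
  \<open>g (\<pi> (minors F)) \<le> W F\<close> for all \<open>F\<close>, and by convexity of \<open>g\<close> this holds if \<open>\<pi> (minors F)\<close> lies in
  the convex hull of the points \<open>m \<nu>\<close> with \<open>\<nu>\<close> ranging over the signed singular values of \<open>F\<close>.

  The diagonals of \<open>F\<close> and \<open>cof F\<close> are \<open>M \<nu>\<close> and \<open>M cof \<nu>\<close>, where \<open>M\<close> is the entrywise product of
  \<open>P\<close> and \<open>Q\<close>. It remains to see that \<open>M\<close> is a convex combination of matrices that preserve signed
  singular values, namely of permutation matrices with an even number of sign changes. For \<open>d = 2\<close>
  the weights are explicit. For \<open>d = 3\<close> these matrices are the symmetries of a regular tetrahedron
  with vertices \<open>l\<^sub>1, \<dots>, l\<^sub>4\<close>. The 4 by 4 matrix with entries \<open>(1 + l\<^sub>j \<bullet> M l\<^sub>k) / 4\<close> is doubly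
  stochastic, because the vertices sum to zero and \<open>l\<^sub>j \<bullet> M l\<^sub>k\<close> is the trace of a rotation of
  three-space, hence at least \<open>- 1\<close>. Birkhoff's theorem for this matrix gives the claim.
\<close>

subsection \<open>Lower semicontinuous convex functions\<close>

lemma lower_semicontinuous_iff_open:
  fixes f :: "'a::topological_space \<Rightarrow> ereal"
  shows "lower_semicontinuous f \<longleftrightarrow> (\<forall>y. open {x. y < f x})"
proof -
  have "open S \<longleftrightarrow> (\<forall>x\<in>S. eventually (\<lambda>z. z \<in> S) (nhds x))" for S :: "'a set"
    unfolding eventually_nhds open_subopen[of S] subset_eq by blast
  then have "open {x. y < f x} \<longleftrightarrow> (\<forall>x. y < f x \<longrightarrow> eventually (\<lambda>z. y < f z) (nhds x))" for y
    by simp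
  then show ?thesis
    unfolding lower_semicontinuous_def le_Liminf_iff eventually_nhds_conv_at by blast
qed

lemma lsc_convex_SUP:
  assumes "I \<noteq> {}" and g: "\<And>i. i \<in> I \<Longrightarrow> lsc_convex (g i)"
  shows "lsc_convex (\<lambda>x. SUP i\<in>I. g i x)"
  unfolding lsc_convex_def
proof (intro conjI)
  show "into_Rinf (\<lambda>x. SUP i\<in>I. g i x)"
    unfolding into_Rinf_def
  proof
    fix x
    obtain i where "i \<in> I" using \<open>I \<noteq> {}\<close> by blast
    then have "- \<infinity> < g i x" "g i x \<le> (SUP i\<in>I. g i x)"
      using g by (auto simp: lsc_convex_def into_Rinf_def intro: SUP_upper)
    then show "(SUP i\<in>I. g i x) \<noteq> - \<infinity>" by auto
  qed
  show "lower_semicontinuous (\<lambda>x. SUP i\<in>I. g i x)"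
    using g unfolding lsc_convex_def lower_semicontinuous_iff_open
    by (auto simp: less_SUP_iff Collect_bex_eq)
  show "convex_ereal (\<lambda>x. SUP i\<in>I. g i x)"
    unfolding convex_ereal_def
  proof (intro allI ballI SUP_least)
    fix x y i and t :: real assume t: "t \<in> {0..1}" and i: "i \<in> I"
    have "g i ((1 - t) *\<^sub>R x + t *\<^sub>R y) \<le> ereal (1 - t) * g i x + ereal t * g i y"
      using g[OF i] t by (simp add: lsc_convex_def convex_ereal_def)
    also have "\<dots> \<le> ereal (1 - t) * (SUP i\<in>I. g i x) + ereal t * (SUP i\<in>I. g i y)"
      using t i by (intro add_mono ereal_mult_left_mono SUP_upper) auto
    finally show "g i ((1 - t) *\<^sub>R x + t *\<^sub>R y)
        \<le> ereal (1 - t) * (SUP i\<in>I. g i x) + ereal t * (SUP i\<in>I. g i y)" .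
  qed
qed

lemma lsc_convex_compose_linear:
  fixes h :: "'a::euclidean_space \<Rightarrow> 'b::euclidean_space"
  assumes g: "lsc_convex g" and h: "linear h"
  shows "lsc_convex (\<lambda>x. g (h x))"
  unfolding lsc_convex_def
proof (intro conjI)
  show "into_Rinf (\<lambda>x. g (h x))"
    using g by (simp add: lsc_convex_def into_Rinf_def)
  show "convex_ereal (\<lambda>x. g (h x))"
    using g by (simp add: lsc_convex_def convex_ereal_def linear_add[OF h] linear_scale[OF h])
  have "open (h -` {z. y < g z})" for y
    using g h by (intro open_vimage)
      (auto simp: lsc_convex_def lower_semicontinuous_iff_open linear_continuous_on linear_linear)
  then show "lower_semicontinuous (\<lambda>x. g (h x))"
    by (simp add: lower_semicontinuous_iff_open vimage_def)
qed

lemma convex_sublevel_set: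
  assumes "convex_ereal g"
  shows "convex {x. g x \<le> a}"
proof (rule convexI, clarsimp)
  fix x y and u v :: real
  assume le: "g x \<le> a" "g y \<le> a" and uv: "0 \<le> u" "0 \<le> v" "u + v = 1"
  have "g (u *\<^sub>R x + v *\<^sub>R y) \<le> ereal u * g x + ereal v * g y"
    using assms uv unfolding convex_ereal_def
    by (metis add_diff_cancel_right' atLeastAtMost_iff le_add_same_cancel2)
  also have "\<dots> \<le> ereal u * a + ereal v * a"
    using le uv by (intro add_mono ereal_mult_left_mono) auto
  also have "\<dots> = a"
    using uv by (simp flip: ereal_left_distrib)
  finally show "g (u *\<^sub>R x + v *\<^sub>R y) \<le> a" .
qed

lemma convex_ereal_le_on_convex_hull:
  assumes "convex_ereal g" "\<And>x. x \<in> S \<Longrightarrow> g x \<le> a" "x \<in> convex hull S"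
  shows "g x \<le> a"
  using hull_minimal[of S "{x. g x \<le> a}" convex] convex_sublevel_set[OF assms(1)] assms(2,3)
  by blast

lemma lsc_polyconvex_compose:
  fixes \<mu> :: "'a \<Rightarrow> 'b::euclidean_space" and m :: "'c \<Rightarrow> 'd::euclidean_space"
  assumes "lsc_polyconvex \<mu> W" "linear h" "\<And>x. \<mu> (f x) = h (m x)"
  shows "lsc_polyconvex m (\<lambda>x. W (f x))"
  using assms lsc_convex_compose_linear unfolding lsc_polyconvex_def by metis

subsection \<open>Birkhoff's theorem\<close>

definition doubly_stochastic :: "real^'n^'n \<Rightarrow> bool" where
  "doubly_stochastic X \<longleftrightarrow> (\<forall>i j. 0 \<le> X $ i $ j) \<and>
     (\<forall>i. (\<Sum>j\<in>UNIV. X $ i $ j) = 1) \<and> (\<forall>j. (\<Sum>i\<in>UNIV. X $ i $ j) = 1)"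

definition permutation_matrix :: "('n \<Rightarrow> 'n) \<Rightarrow> real^'n^'n" where
  "permutation_matrix p = (\<chi> i j. if j = p i then 1 else 0)"

lemma convex_doubly_stochastic: "convex {X. doubly_stochastic X}"
  by (rule convexI)
    (simp add: doubly_stochastic_def sum.distrib flip: sum_distrib_left)

lemma bounded_matrices_norm_rows_le_1: "bounded {A :: real^'n^'m. \<forall>i. norm (A $ i) \<le> 1}"
  unfolding bounded_iff
proof (intro exI ballI)
  fix A :: "real^'n^'m" assume "A \<in> {A. \<forall>i. norm (A $ i) \<le> 1}"
  then have "(\<Sum>i\<in>UNIV. norm (A $ i)) \<le> of_nat (CARD('m)) * 1"
    by (intro sum_bounded_above) auto
  moreover have "norm A \<le> (\<Sum>i\<in>UNIV. norm (A $ i))"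
    unfolding norm_vec_def by (intro L2_set_le_sum) auto
  ultimately show "norm A \<le> CARD('m)" by simp
qed

lemma compact_doubly_stochastic: "compact {X :: real^'n^'n. doubly_stochastic X}"
proof -
  have "norm (X $ i) \<le> 1" if "doubly_stochastic X" for X :: "real^'n^'n" and i
    using that norm_le_l1_cart[of "X $ i"] by (simp add: doubly_stochastic_def)
  then have "bounded {X :: real^'n^'n. doubly_stochastic X}"
    by (intro bounded_subset[OF bounded_matrices_norm_rows_le_1]) blast
  moreover have "closed {X :: real^'n^'n. doubly_stochastic X}"
    unfolding doubly_stochastic_def
    by (intro closed_Collect_conj closed_Collect_all closed_Collect_le closed_Collect_eq)
      (auto intro!: continuous_intros)
  ultimately show ?thesis by (simp add: compact_eq_bounded_closed)
qed

lemma two_card_Domain_le: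
  assumes "finite T" and "\<And>x y. (x, y) \<in> T \<Longrightarrow> \<exists>z. z \<noteq> y \<and> (x, z) \<in> T"
  shows "2 * card (Domain T) \<le> card T"
proof -
  have fin: "finite (Domain T)" "\<And>x. finite (T `` {x})"
    using \<open>finite T\<close> by (auto intro: finite_Domain finite_Image)
  have "2 \<le> card (T `` {x})" if x: "x \<in> Domain T" for x
  proof -
    obtain y where "(x, y) \<in> T" using x by blast
    moreover obtain z where "z \<noteq> y" "(x, z) \<in> T" using assms(2) \<open>(x, y) \<in> T\<close> by blast
    ultimately show ?thesis using card_mono[OF fin(2), of "{y, z}" x] by simp
  qed
  then have "2 * card (Domain T) \<le> (\<Sum>x\<in>Domain T. card (T `` {x}))"
    using sum_bounded_below[of "Domain T" "2 :: nat"] by (simp add: mult.commute)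
  also have "\<dots> = card (SIGMA x:Domain T. T `` {x})"
    using fin by simp
  also have "(SIGMA x:Domain T. T `` {x}) = T" by auto
  finally show ?thesis .
qed

definition edge_vector :: "'m \<times> 'n \<Rightarrow> (real^'m) \<times> (real^'n)" where
  "edge_vector e = (axis (fst e) 1, axis (snd e) 1)"

lemma inj_edge_vector: "inj edge_vector"
  by (auto simp: inj_def edge_vector_def axis_eq_axis)

text \<open>The edge vectors of a bipartite graph span a space of dimension less than the number of
  vertices, because the edges at the endpoints of a fixed edge generate the others.\<close>

lemma dependent_edge_vectors:
  fixes T :: "('m::finite \<times> 'n::finite) set"
  assumes "T \<noteq> {}" and card: "card (Domain T) + card (Range T) \<le> card T"
  shows "dependent (edge_vector ` T)"
proof (rule ccontr)
  assume "\<not> dependent (edge_vector ` T)"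
  obtain i j where ij: "(i, j) \<in> T" using \<open>T \<noteq> {}\<close> by auto
  define A where "A = (\<lambda>k. edge_vector (k, j)) ` (Domain T - {i})"
  define C where "C = (\<lambda>l. edge_vector (i, l)) ` (Range T - {j})"
  define B where "B = insert (edge_vector (i, j)) (A \<union> C)"
  have "edge_vector (k, l) \<in> span B" if "(k, l) \<in> T" for k l
  proof -
    have "edge_vector (k, j) \<in> B" "edge_vector (i, l) \<in> B" "edge_vector (i, j) \<in> B"
      using that by (auto simp: B_def A_def C_def)
    moreover have "edge_vector (k, l)
        = edge_vector (k, j) + edge_vector (i, l) - edge_vector (i, j)"
      by (simp add: edge_vector_def)
    ultimately show ?thesis by (metis span_add span_base span_diff)
  qed
  then have "card (edge_vector ` T) \<le> card B"
    using \<open>\<not> dependent _\<close>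
    by (intro conjunct2[OF independent_span_bound]) (auto simp: B_def A_def C_def)
  also have "\<dots> \<le> Suc (card A + card C)"
    using card_Un_le[of A C] by (simp add: B_def A_def C_def card_insert_if)
  also have "\<dots> \<le> Suc (card (Domain T - {i}) + card (Range T - {j}))"
    unfolding A_def C_def by (intro Suc_le_mono[THEN iffD2] add_mono card_image_le) auto
  also have "\<dots> < card (Domain T) + card (Range T)"
  proof -
    have "card (Domain T) = Suc (card (Domain T - {i}))"
      "card (Range T) = Suc (card (Range T - {j}))"
      using ij by (auto intro!: card.remove)
    then show ?thesis by linarith
  qed
  also have "\<dots> \<le> card (edge_vector ` T)"
    using card by (simp add: card_image[OF inj_on_subset[OF inj_edge_vector]])
  finally show False by simp
qed

lemma zero_margins_matrix_exists:
  fixes T :: "('m::finite \<times> 'n::finite) set"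
  assumes "T \<noteq> {}"
    and "\<And>i j. (i, j) \<in> T \<Longrightarrow> \<exists>k. k \<noteq> j \<and> (i, k) \<in> T"
    and "\<And>i j. (i, j) \<in> T \<Longrightarrow> \<exists>k. k \<noteq> i \<and> (k, j) \<in> T"
  obtains Z :: "real^'n^'m" where "Z \<noteq> 0" "\<And>i j. (i, j) \<notin> T \<Longrightarrow> Z $ i $ j = 0"
    "\<And>i. (\<Sum>j\<in>UNIV. Z $ i $ j) = 0" "\<And>j. (\<Sum>i\<in>UNIV. Z $ i $ j) = 0"
proof -
  have "2 * card (Domain T) \<le> card T" "2 * card (Domain (T\<inverse>)) \<le> card (T\<inverse>)"
    using assms by (intro two_card_Domain_le; auto)+
  then have "card (Domain T) + card (Range T) \<le> card T" by simp
  then obtain u t where u: "(\<Sum>v\<in>edge_vector ` T. u v *\<^sub>R v) = 0"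
    and t: "t \<in> T" "u (edge_vector t) \<noteq> 0"
    using dependent_edge_vectors[OF \<open>T \<noteq> {}\<close>] by (auto simp: dependent_finite)
  define Z :: "real^'n^'m" where "Z = (\<chi> i j. if (i, j) \<in> T then u (edge_vector (i, j)) else 0)"
  have "(\<Sum>v\<in>edge_vector ` T. u v *\<^sub>R v) = (\<Sum>e\<in>T. u (edge_vector e) *\<^sub>R edge_vector e)"
    by (simp add: sum.reindex[OF inj_on_subset[OF inj_edge_vector]])
  also have "\<dots> = (\<Sum>e\<in>UNIV. Z $ fst e $ snd e *\<^sub>R edge_vector e)"
    by (intro sum.mono_neutral_cong_left) (auto simp: Z_def)
  also have "\<dots> = (\<Sum>i\<in>UNIV. \<Sum>j\<in>UNIV. Z $ i $ j *\<^sub>R edge_vector (i, j))"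
    by (simp add: sum.cartesian_product split_beta)
  finally have sum_zero: "(\<Sum>i\<in>UNIV. \<Sum>j\<in>UNIV. Z $ i $ j *\<^sub>R edge_vector (i, j)) = 0"
    using u by simp
  then have sum_zero_swapped: "(\<Sum>j\<in>UNIV. \<Sum>i\<in>UNIV. Z $ i $ j *\<^sub>R edge_vector (i, j)) = 0"
    by (subst sum.swap)
  show thesis
  proof
    have "Z $ fst t $ snd t \<noteq> 0" using t by (simp add: Z_def)
    then show "Z \<noteq> 0" by auto
    show "Z $ i $ j = 0" if "(i, j) \<notin> T" for i j using that by (simp add: Z_def)
    show "(\<Sum>j\<in>UNIV. Z $ i $ j) = 0" for i
      using arg_cong[OF sum_zero_swapped, of "\<lambda>v. fst v $ i"]
      by (simp add: edge_vector_def fst_sum axis_def if_distrib cong: if_cong)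
    show "(\<Sum>i\<in>UNIV. Z $ i $ j) = 0" for j
      using arg_cong[OF sum_zero, of "\<lambda>v. snd v $ j"]
      by (simp add: edge_vector_def snd_sum axis_def if_distrib cong: if_cong)
  qed
qed

lemma two_members_le_sum:
  fixes f :: "'a \<Rightarrow> real"
  assumes "finite A" "j \<in> A" "k \<in> A" "j \<noteq> k" "\<And>x. x \<in> A \<Longrightarrow> 0 \<le> f x"
  shows "f j + f k \<le> sum f A"
  using sum_mono2[of A "{j, k}" f] assms by simp

lemma two_fractions_of_sum_1:
  fixes f :: "'a \<Rightarrow> real"
  assumes A: "finite A" "j \<in> A" and f: "\<And>x. x \<in> A \<Longrightarrow> 0 \<le> f x" "sum f A = 1"
    and "0 < f j" "f j < 1"
  shows "\<exists>k\<in>A. k \<noteq> j \<and> 0 < f k \<and> f k < 1"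
proof -
  have "sum f (A - {j}) > 0" using A f \<open>f j < 1\<close> by (simp add: sum_diff1)
  then obtain k where k: "k \<in> A" "k \<noteq> j" "f k > 0"
    using sum_nonpos[of "A - {j}" f] by force
  with two_members_le_sum[of A j k f] A f \<open>0 < f j\<close> show ?thesis by force
qed

lemma not_extreme_doubly_stochastic:
  fixes X Z :: "real^'n^'n"
  assumes X: "doubly_stochastic X" and "Z \<noteq> 0"
    and supp: "\<And>i j. X $ i $ j = 0 \<Longrightarrow> Z $ i $ j = 0"
    and margins: "\<And>i. (\<Sum>j\<in>UNIV. Z $ i $ j) = 0" "\<And>j. (\<Sum>i\<in>UNIV. Z $ i $ j) = 0"
  shows "\<not> X extreme_point_of {X. doubly_stochastic X}"
proof -
  define T where "T = {(i, j). 0 < X $ i $ j}"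
  have T: "0 < X $ i $ j" if "Z $ i $ j \<noteq> 0" for i j
    using that X supp by (auto simp: doubly_stochastic_def less_le)
  define \<delta> where "\<delta> = Min ((\<lambda>(i, j). X $ i $ j) ` T)"
  have "T \<noteq> {}" using \<open>Z \<noteq> 0\<close> T by (auto simp: T_def vec_eq_iff)
  then have "\<delta> > 0" by (auto simp: \<delta>_def T_def)
  define D where "D = (\<delta> / norm Z) *\<^sub>R Z"
  have "D \<noteq> 0" using \<open>\<delta> > 0\<close> \<open>Z \<noteq> 0\<close> by (simp add: D_def)
  have entry_bound: "\<bar>D $ i $ j\<bar> \<le> X $ i $ j" for i j
  proof (cases "Z $ i $ j = 0")
    case False
    have "\<bar>Z $ i $ j\<bar> \<le> norm Z"
      by (metis Finite_Cartesian_Product.norm_nth_le order_trans real_norm_def)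
    then have "\<bar>D $ i $ j\<bar> \<le> \<delta>"
      using \<open>\<delta> > 0\<close> \<open>Z \<noteq> 0\<close> by (simp add: D_def abs_mult field_simps)
    also have "\<delta> \<le> X $ i $ j" using T[OF False] by (auto simp: \<delta>_def T_def intro!: Min_le)
    finally show ?thesis .
  qed (use X in \<open>simp add: D_def doubly_stochastic_def\<close>)
  have "0 \<le> X $ i $ j + D $ i $ j" "D $ i $ j \<le> X $ i $ j" for i j
    using entry_bound[of i j] by linarith+
  then have "doubly_stochastic (X + D)" "doubly_stochastic (X - D)"
    using X margins
    by (simp_all add: doubly_stochastic_def D_def sum.distrib sum_subtractf
        flip: sum_distrib_left sum_divide_distrib)
  moreover have "X \<in> open_segment (X + D) (X - D)"
  proof -
    have "X + D \<noteq> X - D"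
      using \<open>D \<noteq> 0\<close> by (simp add: eq_neg_iff_add_eq_0 flip: scaleR_2)
    then have "midpoint (X + D) (X - D) \<in> open_segment (X + D) (X - D)" by simp
    then show ?thesis by (simp add: midpoint_def flip: scaleR_2)
  qed
  ultimately show ?thesis by (auto simp: extreme_point_of_def)
qed

text \<open>Otherwise the entries strictly between 0 and 1 form a bipartite graph of minimum degree two.\<close>

lemma extreme_doubly_stochastic_entry:
  fixes X :: "real^'n^'n"
  assumes extreme: "X extreme_point_of {X. doubly_stochastic X}"
  shows "X $ i $ j \<in> {0, 1}"
proof (rule ccontr)
  have X: "doubly_stochastic X" using extreme by (simp add: extreme_point_of_def)
  define T where "T = {(i, j). 0 < X $ i $ j \<and> X $ i $ j < 1}"
  assume "X $ i $ j \<notin> {0, 1}"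
  moreover have "0 \<le> X $ i $ j" "X $ i $ j \<le> 1"
    using X member_le_sum[of j UNIV "\<lambda>j. X $ i $ j"] by (auto simp: doubly_stochastic_def)
  ultimately have "T \<noteq> {}" by (auto simp: T_def less_le)
  moreover have "\<exists>k. k \<noteq> j \<and> (i, k) \<in> T" if "(i, j) \<in> T" for i j
    using that X two_fractions_of_sum_1[of UNIV j "\<lambda>j. X $ i $ j"]
    by (auto simp: T_def doubly_stochastic_def)
  moreover have "\<exists>k. k \<noteq> i \<and> (k, j) \<in> T" if "(i, j) \<in> T" for i j
    using that X two_fractions_of_sum_1[of UNIV i "\<lambda>i. X $ i $ j"]
    by (auto simp: T_def doubly_stochastic_def)
  ultimately obtain Z :: "real^'n^'n" where Z: "Z \<noteq> 0" "\<And>i j. (i, j) \<notin> T \<Longrightarrow> Z $ i $ j = 0"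
    "\<And>i. (\<Sum>j\<in>UNIV. Z $ i $ j) = 0" "\<And>j. (\<Sum>i\<in>UNIV. Z $ i $ j) = 0"
    by (rule zero_margins_matrix_exists) blast+
  moreover have "Z $ i $ j = 0" if "X $ i $ j = 0" for i j
    using that Z(2) by (simp add: T_def)
  ultimately show False
    using not_extreme_doubly_stochastic[OF X] extreme by blast
qed

lemma doubly_stochastic_0_1_permutation_matrix:
  fixes X :: "real^'n^'n"
  assumes X: "doubly_stochastic X" and entries: "\<And>i j. X $ i $ j \<in> {0, 1}"
  obtains p where "p permutes UNIV" "X = permutation_matrix p"
proof -
  have "\<exists>j. X $ i $ j = 1" for i
    using X entries by (metis doubly_stochastic_def insertE singletonD sum.neutral zero_neq_one)
  then obtain p where p: "\<And>i. X $ i $ p i = 1" by metis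
  have "X $ i $ j = 0" if "j \<noteq> p i" for i j
    using entries[of i j] X that p[of i] two_members_le_sum[of UNIV j "p i" "\<lambda>j. X $ i $ j"]
    by (auto simp: doubly_stochastic_def)
  with p have "X = permutation_matrix p" by (auto simp: vec_eq_iff permutation_matrix_def)
  moreover have "inj p"
  proof (rule injI, rule ccontr)
    fix i k assume "p i = p k" "i \<noteq> k"
    then show False
      using X p[of i] p[of k] two_members_le_sum[of UNIV i k "\<lambda>i. X $ i $ p k"]
      by (simp add: doubly_stochastic_def)
  qed
  then have "p permutes UNIV"
    by (intro bij_imp_permutes) (auto simp: bij_def finite_UNIV_inj_surj)
  ultimately show ?thesis using that by blast
qed

theorem birkhoff:
  fixes X :: "real^'n^'n"
  assumes "doubly_stochastic X"
  shows "X \<in> convex hull (permutation_matrix ` {p. p permutes UNIV})"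
proof -
  have "{X :: real^'n^'n. X extreme_point_of {X. doubly_stochastic X}}
      \<subseteq> permutation_matrix ` {p. p permutes UNIV}"
  proof
    fix X :: "real^'n^'n" assume "X \<in> {X. X extreme_point_of {X. doubly_stochastic X}}"
    then have "doubly_stochastic X" "\<And>i j. X $ i $ j \<in> {0, 1}"
      using extreme_doubly_stochastic_entry by (auto simp: extreme_point_of_def)
    then show "X \<in> permutation_matrix ` {p. p permutes UNIV}"
      by (rule doubly_stochastic_0_1_permutation_matrix) blast
  qed
  then show ?thesis
    using Krein_Milman_Minkowski[OF compact_doubly_stochastic convex_doubly_stochastic] assms
      hull_mono
    by blast
qed

subsection \<open>Rotations and signed singular values\<close>

lemma rotation_matrix_mat_1: "rotation_matrix (mat 1)"
  by (simp add: rotation_matrix_def orthogonal_matrix_id)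

lemma rotation_matrix_mult:
  fixes P Q :: "real^'n^'n"
  shows "rotation_matrix P \<Longrightarrow> rotation_matrix Q \<Longrightarrow> rotation_matrix (P ** Q)"
  by (simp add: rotation_matrix_def orthogonal_matrix_mul det_mul)

lemma rotation_matrix_transpose:
  fixes P :: "real^'n^'n"
  shows "rotation_matrix P \<Longrightarrow> rotation_matrix (transpose P)"
  by (simp add: rotation_matrix_def det_transpose)

lemma rotation_matrix_cancel:
  fixes P :: "real^'n^'n"
  assumes "rotation_matrix P"
  shows "transpose P ** P = mat 1" "P ** transpose P = mat 1"
  using assms by (auto simp: rotation_matrix_def orthogonal_matrix_def)

lemma norm_row_rotation_matrix: "rotation_matrix R \<Longrightarrow> norm (R $ i) = 1"
  for R :: "real^'n^'n"
  by (auto simp: rotation_matrix_def orthogonal_matrix_orthonormal_rows row_def)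

lemma rotation_matrix_entry_le_1:
  fixes R :: "real^'n^'n"
  assumes "rotation_matrix R"
  shows "\<bar>R $ i $ j\<bar> \<le> 1"
  using component_le_norm_cart[of "R $ i" j] by (simp add: norm_row_rotation_matrix[OF assms])

lemma det_rotation_conjugate:
  fixes P Q F :: "real^'n^'n"
  assumes "rotation_matrix P" "rotation_matrix Q"
  shows "det (P ** F ** Q) = det F"
  using assms by (simp add: det_mul rotation_matrix_def)

lemma compact_rotation_matrices: "compact {R :: real^'n^'n. rotation_matrix R}"
proof -
  have "bounded {R :: real^'n^'n. rotation_matrix R}"
    by (rule bounded_subset[OF bounded_matrices_norm_rows_le_1])
      (auto simp: norm_row_rotation_matrix)
  moreover have "closed {R :: real^'n^'n. rotation_matrix R}"
    unfolding rotation_matrix_def orthogonal_matrix matrix_matrix_mult_def transpose_def det_def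
    by (intro closed_Collect_conj closed_Collect_eq continuous_intros continuous_on_vec_lambda)
  ultimately show ?thesis by (simp add: compact_eq_bounded_closed)
qed

definition givens :: "'n \<Rightarrow> 'n \<Rightarrow> real \<Rightarrow> real^'n^'n" where
  "givens i j \<theta> = (\<chi> k l.
     if k = l then (if k = i \<or> k = j then cos \<theta> else 1)
     else if k = i \<and> l = j then - sin \<theta> else if k = j \<and> l = i then sin \<theta> else 0)"

lemma givens_mult:
  fixes A :: "real^'m^'n"
  assumes "i \<noteq> j"
  shows "(givens i j \<theta> ** A) $ k $ l =
    (if k = i then cos \<theta> * A $ i $ l - sin \<theta> * A $ j $ l
     else if k = j then sin \<theta> * A $ i $ l + cos \<theta> * A $ j $ l else A $ k $ l)"
proof -
  have "givens i j \<theta> $ k $ m * A $ m $ l =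
      (if k = i then (if m = i then cos \<theta> * A $ i $ l else 0)
         + (if m = j then - sin \<theta> * A $ j $ l else 0)
       else if k = j then (if m = i then sin \<theta> * A $ i $ l else 0)
         + (if m = j then cos \<theta> * A $ j $ l else 0)
       else if m = k then A $ k $ l else 0)" for m
    using assms by (auto simp: givens_def)
  then show ?thesis by (simp add: matrix_matrix_mult_def sum.distrib)
qed

lemma givens_add: "i \<noteq> j \<Longrightarrow> givens i j \<alpha> ** givens i j \<beta> = givens i j (\<alpha> + \<beta>)"
  by (auto simp: vec_eq_iff givens_mult) (auto simp: givens_def cos_add sin_add)

lemma rotation_matrix_givens:
  assumes "i \<noteq> j"
  shows "rotation_matrix (givens i j \<theta>)"
proof -
  have "transpose (givens i j \<theta>) = givens i j (- \<theta>)" for \<theta>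
    using assms by (auto simp: vec_eq_iff transpose_def givens_def)
  moreover have "givens i j 0 = mat 1"
    by (auto simp: vec_eq_iff givens_def mat_def)
  ultimately have orthogonal: "orthogonal_matrix (givens i j \<theta>)" for \<theta>
    using assms by (simp add: orthogonal_matrix givens_add)
  have "det (givens i j \<theta>) = det (givens i j (\<theta> / 2)) * det (givens i j (\<theta> / 2))"
    using assms by (simp flip: det_mul add: givens_add)
  with det_orthogonal_matrix[OF orthogonal[of "\<theta> / 2"]] orthogonal show ?thesis
    by (auto simp: rotation_matrix_def)
qed

lemma cos_sin_maximum_at_0:
  fixes a b :: real
  assumes "\<And>\<theta>. a * cos \<theta> + b * sin \<theta> \<le> a"
  shows "b = 0"
proof -
  have "((\<lambda>\<theta>. a * cos \<theta> + b * sin \<theta>) has_real_derivative b) (at 0)"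
    by (auto intro!: derivative_eq_intros)
  then show ?thesis
    by (rule DERIV_local_max[where d = 1]) (use assms in auto)
qed

lemma transpose_eq_if_trace_rotation_le:
  fixes A :: "real^'n^'n"
  assumes max: "\<And>R. rotation_matrix R \<Longrightarrow> trace (R ** A) \<le> trace A"
  shows "transpose A = A"
proof -
  have "A $ i $ j = A $ j $ i" if "i \<noteq> j" for i j
  proof -
    have trace: "trace B = B $ i $ i + B $ j $ j + (\<Sum>k\<in>UNIV - {i, j}. B $ k $ k)"
      for B :: "real^'n^'n"
      using that sum.subset_diff[of "{i, j}" UNIV "\<lambda>k. B $ k $ k"] by (simp add: trace_def)
    have "(A $ i $ i + A $ j $ j) * cos \<theta> + (A $ i $ j - A $ j $ i) * sin \<theta>
        \<le> A $ i $ i + A $ j $ j" for \<theta>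
      using max[OF rotation_matrix_givens[OF that, of \<theta>]] that
      unfolding trace by (simp add: givens_mult algebra_simps)
    from cos_sin_maximum_at_0[OF this] show ?thesis by simp
  qed
  then show ?thesis by (simp add: vec_eq_iff transpose_def) metis
qed

lemma mult_diag_nth: "(A ** diag d) $ i $ j = A $ i $ j * d $ j"
  for A :: "real^'n^'m"
  by (simp add: matrix_matrix_mult_def diag_def if_distrib cong: if_cong)

lemma diag_mult_nth: "(diag d ** A) $ i $ j = d $ i * A $ i $ j"
  for A :: "real^'n^'m"
  by (simp add: matrix_matrix_mult_def diag_def if_distrib if_distribR cong: if_cong)

definition diagonal :: "real^'n^'n \<Rightarrow> real^'n" where
  "diagonal A = (\<chi> i. A $ i $ i)"

lemma diagonal_diag [simp]: "diagonal (diag \<nu>) = \<nu>"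
  by (simp add: diagonal_def diag_def vec_eq_iff)

lemma eq_diag_if_symmetric_products:
  fixes A :: "real^'n^'n"
  assumes "transpose (A ** diag d) = A ** diag d" "transpose (diag d ** A) = diag d ** A"
    and pos: "\<And>i. 0 < d $ i" and "inj (($) d)"
  shows "A = diag (diagonal A)"
proof -
  have "A $ i $ j = 0" if "i \<noteq> j" for i j
  proof -
    have "A $ i $ j * d $ j = A $ j $ i * d $ i" "d $ i * A $ i $ j = d $ j * A $ j $ i"
      using assms(1,2) by (auto simp: vec_eq_iff transpose_def mult_diag_nth diag_mult_nth)
    then have "((d $ i)\<^sup>2 - (d $ j)\<^sup>2) * A $ i $ j = 0" by algebra
    moreover have "(d $ i)\<^sup>2 \<noteq> (d $ j)\<^sup>2"
      using pos[of i] pos[of j] \<open>inj _\<close> that by (simp add: power2_eq_iff_nonneg inj_eq)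
    ultimately show ?thesis by simp
  qed
  then show ?thesis by (auto simp: vec_eq_iff diag_def diagonal_def)
qed

lemma trace_maximising_rotations_exist:
  fixes F D :: "real^'n^'n"
  obtains P Q where "rotation_matrix P" "rotation_matrix Q"
    "\<And>P' Q'. rotation_matrix P' \<Longrightarrow> rotation_matrix Q' \<Longrightarrow>
      trace (P' ** F ** Q' ** D) \<le> trace (P ** F ** Q ** D)"
proof -
  let ?SO = "{R :: real^'n^'n. rotation_matrix R}"
  have "mat 1 \<in> ?SO" by (simp add: rotation_matrix_mat_1)
  then have "\<exists>x\<in>?SO \<times> ?SO. \<forall>y\<in>?SO \<times> ?SO.
      trace (fst y ** F ** snd y ** D) \<le> trace (fst x ** F ** snd x ** D)"
    by (intro continuous_attains_sup compact_Times compact_rotation_matrices)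
      (auto simp: trace_def matrix_matrix_mult_def intro!: continuous_intros)
  then show ?thesis using that by auto
qed

text \<open>Rotations maximising the trace of \<open>P F Q\<close> against a fixed diagonal matrix with distinct
  positive entries diagonalise \<open>F\<close>.\<close>

theorem signed_singular_value_decomposition:
  fixes F :: "real^'n^'n"
  obtains P Q \<nu> where "rotation_matrix P" "rotation_matrix Q" "F = P ** diag \<nu> ** transpose Q"
proof -
  obtain h :: "'n \<Rightarrow> nat" where "inj h"
    using finite_imp_inj_to_nat_seg[of "UNIV :: 'n set"] by auto
  define d :: "real^'n" where "d = (\<chi> k. real (h k) + 1)"
  obtain P Q where PQ: "rotation_matrix P" "rotation_matrix Q"
    and max: "\<And>P' Q'. rotation_matrix P' \<Longrightarrow> rotation_matrix Q' \<Longrightarrow>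
      trace (P' ** F ** Q' ** diag d) \<le> trace (P ** F ** Q ** diag d)"
    using trace_maximising_rotations_exist[of F "diag d"] by blast
  define A where "A = P ** F ** Q"
  have "transpose (A ** diag d) = A ** diag d"
    using max[OF rotation_matrix_mult[OF _ PQ(1)] PQ(2)]
    by (intro transpose_eq_if_trace_rotation_le) (simp add: A_def matrix_mul_assoc)
  moreover have "transpose (diag d ** A) = diag d ** A"
  proof (rule transpose_eq_if_trace_rotation_le)
    fix R :: "real^'n^'n" assume "rotation_matrix R"
    have "trace (R ** (diag d ** A)) = trace (A ** R ** diag d)"
      by (metis matrix_mul_assoc trace_mul_sym)
    also have "\<dots> \<le> trace (A ** diag d)"
      using max[OF PQ(1) rotation_matrix_mult[OF PQ(2) \<open>rotation_matrix R\<close>]]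
      by (simp add: A_def matrix_mul_assoc)
    finally show "trace (R ** (diag d ** A)) \<le> trace (diag d ** A)"
      by (simp only: trace_mul_sym[of "diag d"])
  qed
  ultimately have A: "diag (diagonal A) = A"
    using \<open>inj h\<close> by (intro eq_diag_if_symmetric_products[symmetric]) (auto simp: d_def inj_def)
  have "transpose P ** A ** transpose Q = (transpose P ** P) ** F ** (Q ** transpose Q)"
    by (simp add: A_def matrix_mul_assoc)
  then have "F = transpose P ** diag (diagonal A) ** transpose Q"
    using PQ by (simp add: A rotation_matrix_cancel)
  then show ?thesis
    using PQ that rotation_matrix_transpose by blast
qed

definition signed_singular_values :: "real^'n^'n \<Rightarrow> (real^'n) set" where
  "signed_singular_values F =
     {\<nu>. \<exists>P Q. rotation_matrix P \<and> rotation_matrix Q \<and> F = P ** diag \<nu> ** transpose Q}"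

lemma signed_singular_valuesI:
  "rotation_matrix P \<Longrightarrow> rotation_matrix Q \<Longrightarrow> F = P ** diag \<nu> ** transpose Q \<Longrightarrow>
    \<nu> \<in> signed_singular_values F"
  unfolding signed_singular_values_def by blast

subsection \<open>Isotropic functions\<close>

lemma isotropicD:
  assumes "isotropic W" "rotation_matrix P" "rotation_matrix Q"
  shows "W (P ** F ** Q) = W F"
  by (rule assms(1)[unfolded isotropic_def, rule_format, OF assms(2,3), symmetric])

lemma isotropic_signed_singular_values:
  assumes "isotropic W" and "\<nu> \<in> signed_singular_values F"
  shows "W (diag \<nu>) = W F"
proof -
  obtain P Q where "rotation_matrix P" "rotation_matrix Q" "F = P ** diag \<nu> ** transpose Q"
    using assms(2) by (auto simp: signed_singular_values_def)
  then show ?thesis by (simp add: isotropicD[OF assms(1)] rotation_matrix_transpose)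
qed

lemma rotate_to_diag:
  fixes F :: "real^'n^'n"
  obtains P Q \<nu> where "rotation_matrix P" "rotation_matrix Q" "P ** F ** Q = diag \<nu>"
proof -
  obtain P Q \<nu> where PQ: "rotation_matrix P" "rotation_matrix Q"
    and F: "F = P ** diag \<nu> ** transpose Q"
    by (rule signed_singular_value_decomposition)
  have "transpose P ** F ** Q = (transpose P ** P) ** diag \<nu> ** (transpose Q ** Q)"
    by (simp add: F matrix_mul_assoc)
  then show ?thesis
    using PQ that[of "transpose P" Q \<nu>]
    by (simp add: rotation_matrix_cancel rotation_matrix_transpose)
qed

theorem isotropic_lsc_polyconvexI:
  fixes W :: "real^'n^'n \<Rightarrow> ereal"
    and \<mu> :: "real^'n^'n \<Rightarrow> 'b::euclidean_space" and m :: "real^'n \<Rightarrow> 'c::euclidean_space"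
  assumes W: "isotropic W" and m: "lsc_polyconvex m (\<lambda>\<nu>. W (diag \<nu>))"
    and \<pi>: "linear \<pi>" "\<And>\<nu>. \<pi> (\<mu> (diag \<nu>)) = m \<nu>"
    and L: "\<And>P Q. linear (L P Q)"
      "\<And>P Q F. rotation_matrix P \<Longrightarrow> rotation_matrix Q \<Longrightarrow> \<mu> (P ** F ** Q) = L P Q (\<mu> F)"
    and hull: "\<And>F. \<pi> (\<mu> F) \<in> convex hull (m ` signed_singular_values F)"
  shows "lsc_polyconvex \<mu> W"
proof -
  obtain g where g: "lsc_convex g" and W_diag: "\<And>\<nu>. W (diag \<nu>) = g (m \<nu>)"
    using m by (auto simp: lsc_polyconvex_def)
  let ?SO = "{R :: real^'n^'n. rotation_matrix R}"
  define G where "G x = (SUP (P, Q)\<in>?SO \<times> ?SO. g (\<pi> (L P Q x)))" for x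
  have "lsc_convex (\<lambda>x. g (\<pi> (L P Q x)))" for P Q
    using lsc_convex_compose_linear[OF g linear_compose[OF L(1) \<pi>(1)]] by (simp add: o_def)
  then have "lsc_convex G"
    unfolding G_def using rotation_matrix_mat_1 by (intro lsc_convex_SUP) auto
  moreover have "W F = G (\<mu> F)" for F
  proof (rule antisym)
    obtain P Q \<nu> where PQ: "rotation_matrix P" "rotation_matrix Q"
      and diag: "P ** F ** Q = diag \<nu>"
      by (rule rotate_to_diag)
    have "W F = W (P ** F ** Q)" by (simp only: isotropicD[OF W PQ])
    also have "\<dots> = g (\<pi> (\<mu> (P ** F ** Q)))" by (simp add: diag W_diag \<pi>(2))
    also have "\<dots> = g (\<pi> (L P Q (\<mu> F)))" by (simp only: L(2)[OF PQ])
    also have "\<dots> \<le> G (\<mu> F)"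
      unfolding G_def using PQ by (intro SUP_upper2[where i = "(P, Q)"]) simp_all
    finally show "W F \<le> G (\<mu> F)" .
    have W_le: "g (\<pi> (\<mu> F)) \<le> W F" for F
    proof (rule convex_ereal_le_on_convex_hull[OF _ _ hull])
      show "g z \<le> W F" if "z \<in> m ` signed_singular_values F" for z
        using that isotropic_signed_singular_values[OF W] by (auto simp flip: W_diag)
    qed (use g in \<open>simp add: lsc_convex_def\<close>)
    have "g (\<pi> (L P Q (\<mu> F))) \<le> W F" if "rotation_matrix P" "rotation_matrix Q" for P Q
      using W_le[of "P ** F ** Q"] unfolding L(2)[OF that] isotropicD[OF W that] .
    then show "G (\<mu> F) \<le> W F"
      unfolding G_def by (intro SUP_least) auto
  qed
  ultimately show ?thesis unfolding lsc_polyconvex_def by blast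
qed

subsection \<open>Entrywise products of rotations\<close>

definition diag_symmetries :: "(real^'n^'n) set" where
  "diag_symmetries = {S. \<exists>P Q. rotation_matrix P \<and> rotation_matrix Q \<and>
     (\<forall>\<nu>. diag (S *v \<nu>) = P ** diag \<nu> ** transpose Q)}"

lemma diag_symmetries_mat_1: "mat 1 \<in> diag_symmetries"
  using rotation_matrix_mat_1 by (fastforce simp: diag_symmetries_def)

lemma diag_symmetries_mult:
  assumes "S \<in> diag_symmetries" "T \<in> diag_symmetries"
  shows "S ** T \<in> diag_symmetries"
proof -
  obtain P Q P' Q' where rot: "rotation_matrix P" "rotation_matrix Q"
      "rotation_matrix P'" "rotation_matrix Q'"
    and "\<And>\<nu>. diag (S *v \<nu>) = P ** diag \<nu> ** transpose Q"
      "\<And>\<nu>. diag (T *v \<nu>) = P' ** diag \<nu> ** transpose Q'"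
    using assms by (auto simp: diag_symmetries_def)
  then have "diag ((S ** T) *v \<nu>) = (P ** P') ** diag \<nu> ** transpose (Q ** Q')" for \<nu>
    by (simp add: matrix_vector_mul_assoc[symmetric] matrix_transpose_mul matrix_mul_assoc)
  then show ?thesis
    using rot rotation_matrix_mult unfolding diag_symmetries_def by blast
qed

lemma diag_symmetry_signed_singular_values:
  assumes "S \<in> diag_symmetries" "\<nu> \<in> signed_singular_values F"
  shows "S *v \<nu> \<in> signed_singular_values F"
proof -
  obtain P Q P' Q' where rot: "rotation_matrix P" "rotation_matrix Q"
      "rotation_matrix P'" "rotation_matrix Q'"
    and S: "diag (S *v \<nu>) = P ** diag \<nu> ** transpose Q"
    and F: "F = P' ** diag \<nu> ** transpose Q'"
    using assms by (auto simp: diag_symmetries_def signed_singular_values_def)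
  have "F = P' ** (transpose P ** P) ** diag \<nu> ** (transpose Q ** Q) ** transpose Q'"
    using rot F by (simp add: rotation_matrix_cancel)
  also have "\<dots> = (P' ** transpose P) ** diag (S *v \<nu>) ** transpose (Q' ** transpose Q)"
    by (simp add: S matrix_transpose_mul matrix_mul_assoc)
  finally show ?thesis
    by (rule signed_singular_valuesI[rotated 2])
      (intro rotation_matrix_mult rotation_matrix_transpose rot)+
qed

lemma det_diag_symmetry:
  assumes "S \<in> diag_symmetries"
  shows "det (diag (S *v \<nu>)) = det (diag \<nu>)"
proof -
  obtain P Q where "rotation_matrix P" "rotation_matrix Q"
    and "diag (S *v \<nu>) = P ** diag \<nu> ** transpose Q"
    using assms by (auto simp: diag_symmetries_def)
  then show ?thesis by (simp add: det_rotation_conjugate rotation_matrix_transpose)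
qed

text \<open>On matrices, \<open>*\<close> is the entrywise product and \<open>1\<close> the matrix with all entries equal to one, in
  contrast to \<open>**\<close> and \<open>mat 1\<close>.\<close>

lemma diagonal_diag_conjugate: "diagonal (P ** diag \<nu> ** transpose Q) = (P * Q) *v \<nu>"
  by (simp add: diagonal_def vec_eq_iff matrix_vector_mult_def
      matrix_matrix_mult_def[of "P ** diag \<nu>"] mult_diag_nth transpose_def ac_simps)

lemma inner_hadamard_eq_trace:
  fixes P Q :: "real^'n^'m"
  shows "v \<bullet> ((P * Q) *v w) = trace (transpose (diag v ** P ** diag w) ** Q)"
proof -
  have "trace (transpose A ** Q) = (\<Sum>i\<in>UNIV. \<Sum>j\<in>UNIV. A $ i $ j * Q $ i $ j)" for A
    unfolding trace_def by (subst sum.swap) (simp add: matrix_matrix_mult_def transpose_def)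
  then show ?thesis
    by (simp add: diag_mult_nth mult_diag_nth inner_vec_def matrix_vector_mult_def
        sum_distrib_left ac_simps)
qed

lemma convex_hull_linear_image_add:
  assumes "linear h" "convex C" "\<And>x. x \<in> S \<Longrightarrow> h x + a \<in> C" "x \<in> convex hull S"
  shows "h x + a \<in> C"
proof -
  have "h ` S \<subseteq> (\<lambda>z. - a + z) ` C" using assms(3) by (force simp: image_iff)
  then have "convex hull (h ` S) \<subseteq> (\<lambda>z. - a + z) ` C"
    using assms(2) by (intro hull_minimal convex_translation)
  moreover have "h x \<in> convex hull (h ` S)"
    using assms(1,4) by (metis convex_hull_linear_image image_eqI)
  ultimately show ?thesis by auto
qed

lemma linear_hadamard_add_in_hull:
  fixes P Q :: "real^'n^'n"
  assumes PQ: "rotation_matrix P" "rotation_matrix Q" "P * Q \<in> convex hull diag_symmetries"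
    and h: "linear h" and m: "\<And>S. S \<in> diag_symmetries \<Longrightarrow> m (S *v \<nu>) = h S + a"
  shows "h (P * Q) + a
    \<in> convex hull (m ` signed_singular_values (P ** diag \<nu> ** transpose Q))"
proof (rule convex_hull_linear_image_add[OF h convex_convex_hull _ PQ(3)])
  fix S :: "real^'n^'n" assume S: "S \<in> diag_symmetries"
  have "S *v \<nu> \<in> signed_singular_values (P ** diag \<nu> ** transpose Q)"
    using S signed_singular_valuesI[OF PQ(1,2) refl] by (rule diag_symmetry_signed_singular_values)
  then show "h S + a \<in> convex hull (m ` signed_singular_values (P ** diag \<nu> ** transpose Q))"
    unfolding m[OF S, symmetric] by (intro hull_inc imageI)
qed

lemma linear_diag: "linear diag"
  by (rule linearI) (auto simp: vec_eq_iff diag_def)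

lemma linear_diagonal: "linear diagonal"
  by (rule linearI) (auto simp: vec_eq_iff diagonal_def)

lemma linear_map_prod:
  assumes "linear f" "linear g"
  shows "linear (map_prod f g)"
  by (rule linearI)
    (auto simp: linear_add[OF assms(1)] linear_add[OF assms(2)]
      linear_scale[OF assms(1)] linear_scale[OF assms(2)])

lemma matrix_add_rdistrib: "(A + B) ** C = A ** C + B ** C"
  by (simp add: matrix_matrix_mult_def vec_eq_iff distrib_right sum.distrib)

lemma linear_conjugate: "linear (\<lambda>F. A ** F ** B)"
  for A :: "real^'m^'k" and B :: "real^'q^'p"
  by (rule linearI)
    (simp_all add: matrix_add_ldistrib matrix_add_rdistrib matrix_scalar_ac
      flip: scalar_matrix_assoc)

subsection \<open>Dimension two\<close>

lemma rotation_matrix_2: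
  fixes P :: "real^2^2"
  assumes "rotation_matrix P"
  shows "P $ 2 $ 2 = P $ 1 $ 1" "P $ 2 $ 1 = - P $ 1 $ 2"
proof -
  have "transpose P ** P = mat 1" "P ** transpose P = mat 1" "det P = 1"
    using assms by (auto simp: rotation_matrix_cancel rotation_matrix_def)
  then have "P $ 1 $ 1 * P $ 1 $ 1 + P $ 1 $ 2 * P $ 1 $ 2 = 1"
    "P $ 2 $ 1 * P $ 2 $ 1 + P $ 2 $ 2 * P $ 2 $ 2 = 1"
    "P $ 1 $ 1 * P $ 2 $ 1 + P $ 1 $ 2 * P $ 2 $ 2 = 0"
    "P $ 1 $ 1 * P $ 2 $ 2 - P $ 1 $ 2 * P $ 2 $ 1 = 1"
    by (auto simp: vec_eq_iff forall_2 matrix_matrix_mult_def sum_2 transpose_def mat_def det_2)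
  then show "P $ 2 $ 2 = P $ 1 $ 1" "P $ 2 $ 1 = - P $ 1 $ 2" by algebra+
qed

definition swap_2 :: "real^2^2" where
  "swap_2 = vector [vector [0, 1], vector [1, 0]]"

lemma diag_symmetries_2:
  "swap_2 \<in> diag_symmetries" "- mat 1 \<in> (diag_symmetries :: (real^2^2) set)"
  "- swap_2 \<in> diag_symmetries"
proof -
  note matrix_simps = swap_2_def vec_eq_iff forall_2 sum_2 matrix_matrix_mult_def
    matrix_vector_mult_def transpose_def diag_def mat_def
  define R :: "real^2^2" where "R = vector [vector [0, -1], vector [1, 0]]"
  have R: "rotation_matrix R"
    by (simp add: R_def rotation_matrix_def orthogonal_matrix det_2 matrix_simps)
  have "\<forall>\<nu>. diag (swap_2 *v \<nu>) = R ** diag \<nu> ** transpose R"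
    by (simp add: R_def matrix_simps)
  then show swap: "swap_2 \<in> diag_symmetries"
    using R unfolding diag_symmetries_def by blast
  have "\<forall>\<nu>. diag (- mat 1 *v \<nu>) = (R ** R) ** diag \<nu> ** transpose (mat 1)"
    by (simp add: R_def matrix_simps)
  then show minus: "- mat 1 \<in> (diag_symmetries :: (real^2^2) set)"
    using rotation_matrix_mult[OF R R] rotation_matrix_mat_1 unfolding diag_symmetries_def by blast
  have "- swap_2 = (- mat 1) ** swap_2"
    by (simp add: matrix_simps)
  then show "- swap_2 \<in> diag_symmetries"
    using diag_symmetries_mult[OF minus swap] by simp
qed

text \<open>For rotations \<open>P\<close> and \<open>Q\<close> by angles \<open>\<alpha>\<close> and \<open>\<beta>\<close>, the eigenvalues of the entrywise product are
  \<open>cos (\<alpha> - \<beta>)\<close> and \<open>cos (\<alpha> + \<beta>)\<close>.\<close>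

lemma hadamard_rotations_in_hull_2:
  fixes P Q :: "real^2^2"
  assumes P: "rotation_matrix P" and Q: "rotation_matrix Q"
  shows "P * Q \<in> convex hull diag_symmetries"
proof -
  define cos_diff where "cos_diff = (P ** transpose Q) $ 1 $ 1"
  define cos_sum where "cos_sum = (P ** Q) $ 1 $ 1"
  define s t where "s = (1 + cos_diff) / 2" and "t = (1 + cos_sum) / 2"
  have "\<bar>cos_diff\<bar> \<le> 1" "\<bar>cos_sum\<bar> \<le> 1"
    unfolding cos_diff_def cos_sum_def
    by (intro rotation_matrix_entry_le_1 rotation_matrix_mult rotation_matrix_transpose P Q)+
  then have "0 \<le> s" "s \<le> 1" "0 \<le> t" "t \<le> 1" by (auto simp: s_def t_def)
  then have "s *\<^sub>R (t *\<^sub>R mat 1 + (1 - t) *\<^sub>R swap_2)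
      + (1 - s) *\<^sub>R (t *\<^sub>R (- swap_2) + (1 - t) *\<^sub>R (- mat 1)) \<in> convex hull diag_symmetries"
    by (intro convexD convex_convex_hull hull_inc diag_symmetries_2 diag_symmetries_mat_1) simp_all
  also have "s *\<^sub>R (t *\<^sub>R mat 1 + (1 - t) *\<^sub>R swap_2)
      + (1 - s) *\<^sub>R (t *\<^sub>R (- swap_2) + (1 - t) *\<^sub>R (- mat 1)) = P * Q"
    by (simp add: vec_eq_iff forall_2 mat_def swap_2_def s_def t_def cos_diff_def cos_sum_def
        matrix_matrix_mult_def sum_2 transpose_def rotation_matrix_2[OF P] rotation_matrix_2[OF Q]
        field_simps)
  finally show ?thesis .
qed

lemma m2_eq: "m2 \<nu> = (\<nu>, det (diag \<nu>))"
  by (simp add: m2_def det_2 diag_def)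

lemma diagonal_minors2_in_hull:
  "(diagonal F, det F) \<in> convex hull (m2 ` signed_singular_values F)"
proof -
  obtain P Q \<nu> where PQ: "rotation_matrix P" "rotation_matrix Q"
    and F: "F = P ** diag \<nu> ** transpose Q"
    by (rule signed_singular_value_decomposition)
  have "((P * Q) *v \<nu>, 0) + (0, det (diag \<nu>)) \<in> convex hull (m2 ` signed_singular_values F)"
    unfolding F
  proof (rule linear_hadamard_add_in_hull[OF PQ hadamard_rotations_in_hull_2[OF PQ]])
    show "linear (\<lambda>S. (S *v \<nu>, 0 :: real))"
      by (rule linearI) (simp_all add: matrix_vector_mult_add_rdistrib scaleR_matrix_vector_assoc)
  qed (simp add: m2_eq det_diag_symmetry)
  moreover have "det F = det (diag \<nu>)"
    using PQ by (simp add: F det_rotation_conjugate rotation_matrix_transpose)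
  ultimately show ?thesis by (simp add: F diagonal_diag_conjugate)
qed

theorem isotropic_lsc_polyconvex_minors2_iff:
  assumes "isotropic W"
  shows "lsc_polyconvex minors2 W \<longleftrightarrow> lsc_polyconvex m2 (\<lambda>\<nu>. W (diag \<nu>))"
proof
  assume "lsc_polyconvex minors2 W"
  moreover have "linear (map_prod diag id)"
    by (intro linear_map_prod linear_diag linear_id)
  ultimately show "lsc_polyconvex m2 (\<lambda>\<nu>. W (diag \<nu>))"
    by (rule lsc_polyconvex_compose) (simp add: minors2_def m2_eq)
next
  assume "lsc_polyconvex m2 (\<lambda>\<nu>. W (diag \<nu>))"
  with assms show "lsc_polyconvex minors2 W"
  proof (rule isotropic_lsc_polyconvexI[where \<pi> = "map_prod diagonal id"
        and L = "\<lambda>P Q. map_prod (\<lambda>F. P ** F ** Q) id"])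
    show "map_prod diagonal id (minors2 F) \<in> convex hull (m2 ` signed_singular_values F)" for F
      using diagonal_minors2_in_hull by (simp add: minors2_def)
  qed (auto simp: minors2_def m2_eq det_rotation_conjugate
      intro!: linear_map_prod linear_diagonal linear_conjugate linear_id)
qed

subsection \<open>Dimension three\<close>

lemma adjugate_mult_self_3:
  fixes F :: "real^3^3"
  shows "adjugate F ** F = mat (det F)"
  by (simp add: adjugate_3 vec_eq_iff forall_3 matrix_matrix_mult_def sum_3 mat_def det_3
      algebra_simps)

definition cofactor_matrix :: "real^'n^'n \<Rightarrow> real^'n^'n" where
  "cofactor_matrix F = transpose (adjugate F)"

lemma cofactor_matrix_mult_3:
  fixes A B :: "real^3^3"
  shows "cofactor_matrix (A ** B) = cofactor_matrix A ** cofactor_matrix B"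
  by (simp add: cofactor_matrix_def adjugate_3 vec_eq_iff forall_3 transpose_def
      matrix_matrix_mult_def sum_3)
    (simp add: algebra_simps)

lemma cofactor_matrix_rotation_3:
  fixes R :: "real^3^3"
  assumes "rotation_matrix R"
  shows "cofactor_matrix R = R"
proof -
  have "adjugate R = (adjugate R ** R) ** transpose R"
    using assms by (simp add: rotation_matrix_cancel flip: matrix_mul_assoc)
  also have "\<dots> = transpose R"
    using assms by (simp add: adjugate_mult_self_3 rotation_matrix_def)
  finally show ?thesis by (simp add: cofactor_matrix_def)
qed

lemma cofactor_matrix_conjugate_3:
  fixes P Q F :: "real^3^3"
  assumes "rotation_matrix P" "rotation_matrix Q"
  shows "cofactor_matrix (P ** F ** Q) = P ** cofactor_matrix F ** Q"
  using assms by (simp add: cofactor_matrix_mult_3 cofactor_matrix_rotation_3)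

definition cofactors :: "real^3 \<Rightarrow> real^3" where
  "cofactors \<nu> = vector [\<nu> $ 2 * \<nu> $ 3, \<nu> $ 1 * \<nu> $ 3, \<nu> $ 1 * \<nu> $ 2]"

lemma cofactor_matrix_diag_3: "cofactor_matrix (diag \<nu>) = diag (cofactors \<nu>)"
  by (simp add: cofactor_matrix_def adjugate_3 vec_eq_iff forall_3 transpose_def diag_def
      cofactors_def)

lemma cofactors_diag_symmetry:
  assumes "S \<in> diag_symmetries"
  shows "cofactors (S *v \<nu>) = S *v cofactors \<nu>"
proof -
  obtain P Q where PQ: "rotation_matrix P" "rotation_matrix Q"
    and S: "\<And>\<nu>. diag (S *v \<nu>) = P ** diag \<nu> ** transpose Q"
    using assms by (auto simp: diag_symmetries_def)
  have "diag (cofactors (S *v \<nu>)) = diag (S *v cofactors \<nu>)"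
    using PQ
    by (simp add: S cofactor_matrix_conjugate_3 rotation_matrix_transpose
        flip: cofactor_matrix_diag_3)
  then show ?thesis by (metis diagonal_diag)
qed

text \<open>The squared skew part of a rotation \<open>R\<close> equals \<open>(3 - trace R) (1 + trace R)\<close>, because \<open>R\<close> is
  its own cofactor matrix.\<close>

lemma trace_rotation_matrix_3:
  fixes R :: "real^3^3"
  assumes "rotation_matrix R"
  shows "- 1 \<le> trace R"
proof -
  have cofactor: "R$1$1 = R$2$2 * R$3$3 - R$2$3 * R$3$2" "R$2$2 = R$1$1 * R$3$3 - R$1$3 * R$3$1"
    "R$3$3 = R$1$1 * R$2$2 - R$1$2 * R$2$1"
    using cofactor_matrix_rotation_3[OF assms]
    by (simp_all add: cofactor_matrix_def vec_eq_iff forall_3 transpose_def adjugate_3)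
  have row: "(R $ i $ 1)\<^sup>2 + (R $ i $ 2)\<^sup>2 + (R $ i $ 3)\<^sup>2 = 1" for i
    using norm_row_rotation_matrix[OF assms, of i]
    by (simp add: norm_eq_1 inner_vec_def sum_3 power2_eq_square)
  have "(3 - trace R) * (1 + trace R)
      = (R$1$2 - R$2$1)\<^sup>2 + (R$1$3 - R$3$1)\<^sup>2 + (R$2$3 - R$3$2)\<^sup>2"
    using cofactor row[of 1] row[of 2] row[of 3] unfolding trace_def sum_3 by algebra
  then have "0 \<le> (3 - trace R) * (1 + trace R)" by simp
  then show ?thesis by (cases "trace R < - 1") (auto simp: zero_le_mult_iff)
qed

text \<open>The rows of \<open>tetra\<close> are the vertices of a regular tetrahedron. Its symmetries are the
  coordinate permutations combined with an even number of sign changes, so these are indexed by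
  the permutations of the four vertices.\<close>

definition tetra :: "real^3^4" where
  "tetra = (\<chi> k. if k = 1 then vector [1, 1, 1] else if k = 2 then vector [1, -1, -1]
     else if k = 3 then vector [-1, 1, -1] else vector [-1, -1, 1])"

lemma sum_tetra: "(\<Sum>k\<in>UNIV. tetra $ k) = 0"
  by (simp add: vec_eq_iff forall_3 sum_4 tetra_def)

lemma ones_mult_tetra: "(1 :: real^4^4) ** tetra = 0"
  using sum_tetra by (simp add: vec_eq_iff matrix_matrix_mult_def)

lemma transpose_tetra_mult_tetra: "transpose tetra ** tetra = 4 *\<^sub>R mat 1"
  by (simp add: vec_eq_iff forall_3 matrix_matrix_mult_def sum_4 transpose_def tetra_def mat_def)

lemma tetra_mult_transpose_tetra: "tetra ** transpose tetra + 1 = 4 *\<^sub>R mat 1"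
  by (simp add: vec_eq_iff forall_4 matrix_matrix_mult_def sum_3 transpose_def tetra_def mat_def)

lemma rotation_matrix_diag_tetra: "rotation_matrix (diag (tetra $ k))"
  using exhaust_4[of k]
  by (auto simp: rotation_matrix_def orthogonal_matrix tetra_def diag_def vec_eq_iff forall_3
      matrix_matrix_mult_def sum_3 transpose_def mat_def det_3)

definition tetra_action :: "real^4^4 \<Rightarrow> real^3^3" where
  "tetra_action Y = (1 / 4) *\<^sub>R (transpose tetra ** Y ** tetra)"

lemma linear_tetra_action: "linear tetra_action"
  unfolding tetra_action_def by (intro linear_compose_scale_right linear_conjugate)

lemma tetra_action_mult:
  assumes "(1 :: real^4^4) ** B = 1"
  shows "tetra_action (A ** B) = tetra_action A ** tetra_action B"
proof -
  have "4 *\<^sub>R (B ** tetra) = (tetra ** transpose tetra + 1) ** B ** tetra"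
    by (simp add: tetra_mult_transpose_tetra flip: scalar_matrix_assoc)
  also have "\<dots> = 4 *\<^sub>R (tetra ** tetra_action B)"
    by (simp add: tetra_action_def matrix_add_rdistrib assms ones_mult_tetra matrix_mul_assoc
        matrix_scalar_ac flip: scalar_matrix_assoc)
  finally have intertwine: "B ** tetra = tetra ** tetra_action B" by simp
  have "tetra_action (A ** B) = (1 / 4) *\<^sub>R (transpose tetra ** A ** (B ** tetra))"
    by (simp add: tetra_action_def matrix_mul_assoc)
  then show ?thesis
    by (simp add: intertwine tetra_action_def[of A] matrix_mul_assoc flip: scalar_matrix_assoc)
qed

lemma permutation_matrix_mult_nth: "(permutation_matrix p ** A) $ i $ j = A $ p i $ j"
  for A :: "real^'m^'n"
  by (simp add: permutation_matrix_def matrix_matrix_mult_def if_distrib if_distribR cong: if_cong)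

lemma permutation_matrix_mult:
  "permutation_matrix p ** permutation_matrix q = permutation_matrix (q \<circ> p)"
  by (simp add: vec_eq_iff permutation_matrix_mult_nth) (simp add: permutation_matrix_def)

lemma ones_mult_permutation_matrix:
  assumes "p permutes UNIV"
  shows "(1 :: real^'n^'n) ** permutation_matrix p = 1"
proof -
  have "j = p k \<longleftrightarrow> k = inv p j" for j k using permutes_inv_eq[OF assms] by metis
  then show ?thesis by (simp add: permutation_matrix_def matrix_matrix_mult_def vec_eq_iff)
qed

lemma tetra_action_permutation_matrix_nth:
  "tetra_action (permutation_matrix p) $ i $ j = (\<Sum>k\<in>UNIV. tetra $ k $ i * tetra $ p k $ j) / 4"
proof -
  have "tetra_action (permutation_matrix p)
      = (1 / 4) *\<^sub>R (transpose tetra ** (permutation_matrix p ** tetra))"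
    by (simp add: tetra_action_def matrix_mul_assoc)
  then show ?thesis
    by (simp add: matrix_matrix_mult_def[of "transpose tetra"] permutation_matrix_mult_nth)
      (simp add: transpose_def)
qed

text \<open>The transposition of two vertices acts as a reflection \<open>S\<close>, which permutes the coordinate axes
  and therefore is the entrywise product of the rotations \<open>- S\<close> and \<open>- \<bar>S\<bar>\<close>.\<close>

lemma diag_symmetries_tetra_transposition:
  assumes "a \<noteq> b"
  shows "tetra_action (permutation_matrix (Transposition.transpose a b)) \<in> diag_symmetries"
proof -
  define S where "S = tetra_action (permutation_matrix (Transposition.transpose a b))"
  define Q :: "real^3^3" where "Q = (\<chi> i j. - \<bar>S $ i $ j\<bar>)"
  have "rotation_matrix (- S) \<and> rotation_matrix Q \<and>
      (\<forall>\<nu>. diag (S *v \<nu>) = (- S) ** diag \<nu> ** transpose Q)"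
    using exhaust_4[of a] exhaust_4[of b] assms
    by (elim disjE)
      (simp_all add: S_def Q_def tetra_action_permutation_matrix_nth Transposition.transpose_def
        tetra_def sum_4 rotation_matrix_def orthogonal_matrix vec_eq_iff forall_3 sum_3 det_3
        matrix_matrix_mult_def matrix_vector_mult_def transpose_def diag_def mat_def)
  then show ?thesis unfolding S_def diag_symmetries_def by blast
qed

lemma diag_symmetries_tetra_permutation:
  assumes "p permutes UNIV"
  shows "tetra_action (permutation_matrix p) \<in> diag_symmetries"
  using assms finite
proof (induction rule: permutes_induct)
  case id
  have "permutation_matrix id = (mat 1 :: real^4^4)"
    by (auto simp: permutation_matrix_def mat_def vec_eq_iff)
  then have "tetra_action (permutation_matrix id) = mat 1"
    by (simp add: tetra_action_def transpose_tetra_mult_tetra)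
  then show ?case by (simp only: diag_symmetries_mat_1)
next
  case (swap a b p)
  have "tetra_action (permutation_matrix (Transposition.transpose a b \<circ> p))
      = tetra_action (permutation_matrix p)
        ** tetra_action (permutation_matrix (Transposition.transpose a b))"
    by (simp add: ones_mult_permutation_matrix permutes_swap_id
        flip: permutation_matrix_mult tetra_action_mult)
  moreover have "\<dots> \<in> diag_symmetries"
    using swap by (intro diag_symmetries_mult diag_symmetries_tetra_transposition)
  ultimately show ?case by (simp only:)
qed

definition tetra_lift :: "real^3^3 \<Rightarrow> real^4^4" where
  "tetra_lift M = (1 / 4) *\<^sub>R (1 + tetra ** M ** transpose tetra)"

lemma tetra_lift_nth: "tetra_lift M $ j $ k = (1 + tetra $ j \<bullet> (M *v tetra $ k)) / 4"
  by (simp add: tetra_lift_def flip: matrix_mul_assoc)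
    (simp add: matrix_matrix_mult_def matrix_vector_mult_def inner_vec_def transpose_def)

lemma tetra_action_lift: "tetra_action (tetra_lift M) = M"
proof -
  have "tetra_action (tetra_lift M)
      = (1 / 4) *\<^sub>R (tetra_action 1 + tetra_action (tetra ** M ** transpose tetra))"
    by (simp only: tetra_lift_def linear_scale[OF linear_tetra_action]
        linear_add[OF linear_tetra_action])
  also have "tetra_action 1 = 0"
    by (simp add: tetra_action_def ones_mult_tetra flip: matrix_mul_assoc)
  also have "tetra_action (tetra ** M ** transpose tetra)
      = (1 / 4) *\<^sub>R ((transpose tetra ** tetra) ** M ** (transpose tetra ** tetra))"
    by (simp add: tetra_action_def matrix_mul_assoc)
  finally show ?thesis
    by (simp add: transpose_tetra_mult_tetra matrix_scalar_ac flip: scalar_matrix_assoc)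
qed

lemma tetra_lift_row_sum: "(\<Sum>k\<in>UNIV. tetra_lift M $ j $ k) = 1"
proof -
  have "(\<Sum>k\<in>UNIV. tetra $ j \<bullet> (M *v tetra $ k)) = tetra $ j \<bullet> (M *v (\<Sum>k\<in>UNIV. tetra $ k))"
    by (simp add: linear_sum[OF matrix_vector_mul_linear] inner_sum_right)
  then show ?thesis
    by (simp add: tetra_lift_nth sum.distrib sum_tetra flip: sum_divide_distrib)
qed

lemma tetra_lift_column_sum: "(\<Sum>j\<in>UNIV. tetra_lift M $ j $ k) = 1"
  by (simp add: tetra_lift_nth sum.distrib sum_tetra flip: sum_divide_distrib inner_sum_left)

lemma doubly_stochastic_tetra_lift_hadamard:
  assumes "rotation_matrix P" "rotation_matrix Q"
  shows "doubly_stochastic (tetra_lift (P * Q))"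
proof -
  have "0 \<le> tetra_lift (P * Q) $ j $ k" for j k
  proof -
    have "rotation_matrix (transpose (diag (tetra $ j) ** P ** diag (tetra $ k)) ** Q)"
      by (intro rotation_matrix_mult rotation_matrix_transpose rotation_matrix_diag_tetra assms)
    from trace_rotation_matrix_3[OF this] show ?thesis
      by (simp add: tetra_lift_nth inner_hadamard_eq_trace)
  qed
  then show ?thesis
    by (simp add: doubly_stochastic_def tetra_lift_row_sum tetra_lift_column_sum)
qed

lemma hadamard_rotations_in_hull_3:
  fixes P Q :: "real^3^3"
  assumes "rotation_matrix P" "rotation_matrix Q"
  shows "P * Q \<in> convex hull diag_symmetries"
proof -
  have "tetra_lift (P * Q) \<in> convex hull (permutation_matrix ` {p. p permutes UNIV})"
    using assms by (intro birkhoff doubly_stochastic_tetra_lift_hadamard)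
  then have "P * Q \<in> tetra_action ` (convex hull (permutation_matrix ` {p. p permutes UNIV}))"
    using imageI[of _ _ tetra_action] by (metis tetra_action_lift)
  also have "\<dots> = convex hull (tetra_action ` permutation_matrix ` {p. p permutes UNIV})"
    by (rule convex_hull_linear_image[OF linear_tetra_action])
  also have "\<dots> \<subseteq> convex hull diag_symmetries"
    using diag_symmetries_tetra_permutation by (intro hull_mono) blast
  finally show ?thesis .
qed

lemma minors3_eq: "minors3 F = (F, cofactor_matrix F, det F)"
  by (simp add: minors3_def cofactor_matrix_def)

lemma m3_eq: "m3 \<nu> = (\<nu>, cofactors \<nu>, det (diag \<nu>))"
  by (simp add: m3_def cofactors_def det_3 diag_def)

lemma diagonal_minors3_in_hull:
  "(diagonal F, diagonal (cofactor_matrix F), det F) \<in> convex hull (m3 ` signed_singular_values F)"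
proof -
  obtain P Q \<nu> where PQ: "rotation_matrix P" "rotation_matrix Q"
    and F: "F = P ** diag \<nu> ** transpose Q"
    by (rule signed_singular_value_decomposition)
  have "((P * Q) *v \<nu>, (P * Q) *v cofactors \<nu>, 0) + (0, 0, det (diag \<nu>))
      \<in> convex hull (m3 ` signed_singular_values F)"
    unfolding F
  proof (rule linear_hadamard_add_in_hull[OF PQ hadamard_rotations_in_hull_3[OF PQ]])
    show "linear (\<lambda>S. (S *v \<nu>, S *v cofactors \<nu>, 0 :: real))"
      by (rule linearI) (simp_all add: matrix_vector_mult_add_rdistrib scaleR_matrix_vector_assoc)
  qed (simp add: m3_eq cofactors_diag_symmetry det_diag_symmetry)
  moreover have "cofactor_matrix F = P ** diag (cofactors \<nu>) ** transpose Q" "det F = det (diag \<nu>)"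
    using PQ by (simp_all add: F cofactor_matrix_conjugate_3 cofactor_matrix_diag_3
        det_rotation_conjugate rotation_matrix_transpose)
  ultimately show ?thesis by (simp add: F diagonal_diag_conjugate)
qed

theorem isotropic_lsc_polyconvex_minors3_iff:
  assumes "isotropic W"
  shows "lsc_polyconvex minors3 W \<longleftrightarrow> lsc_polyconvex m3 (\<lambda>\<nu>. W (diag \<nu>))"
proof
  assume "lsc_polyconvex minors3 W"
  moreover have "linear (map_prod diag (map_prod diag id))"
    by (intro linear_map_prod linear_diag linear_id)
  ultimately show "lsc_polyconvex m3 (\<lambda>\<nu>. W (diag \<nu>))"
    by (rule lsc_polyconvex_compose) (simp add: minors3_eq m3_eq cofactor_matrix_diag_3)
next
  assume "lsc_polyconvex m3 (\<lambda>\<nu>. W (diag \<nu>))"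
  with assms show "lsc_polyconvex minors3 W"
  proof (rule isotropic_lsc_polyconvexI[where \<pi> = "map_prod diagonal (map_prod diagonal id)"
        and L = "\<lambda>P Q. map_prod (\<lambda>F. P ** F ** Q) (map_prod (\<lambda>F. P ** F ** Q) id)"])
    show "map_prod diagonal (map_prod diagonal id) (minors3 F)
        \<in> convex hull (m3 ` signed_singular_values F)" for F
      using diagonal_minors3_in_hull by (simp add: minors3_eq)
  qed (auto simp: minors3_eq m3_eq cofactor_matrix_diag_3 cofactor_matrix_conjugate_3
      det_rotation_conjugate intro!: linear_map_prod linear_diagonal linear_conjugate linear_id)
qed

theorem theorem1p4:
  shows
    "(\<forall>(W :: real^2^2 \<Rightarrow> ereal) (\<Phi> :: real^2 \<Rightarrow> ereal).
        into_Rinf W \<longrightarrow> isotropic W \<longrightarrow> (\<forall>\<nu>. \<Phi> \<nu> = W (diag \<nu>)) \<longrightarrow>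
          (lsc_polyconvex minors2 W \<longleftrightarrow>
             (\<exists>g :: (real^2) \<times> real \<Rightarrow> ereal. lsc_convex g \<and> (\<forall>\<nu>. W (diag \<nu>) = g (m2 \<nu>)))) \<and>
          ((\<exists>g :: (real^2) \<times> real \<Rightarrow> ereal. lsc_convex g \<and> (\<forall>\<nu>. W (diag \<nu>) = g (m2 \<nu>))) \<longleftrightarrow>
             lsc_polyconvex m2 \<Phi>)) \<and>
     (\<forall>(W :: real^3^3 \<Rightarrow> ereal) (\<Phi> :: real^3 \<Rightarrow> ereal).
        into_Rinf W \<longrightarrow> isotropic W \<longrightarrow> (\<forall>\<nu>. \<Phi> \<nu> = W (diag \<nu>)) \<longrightarrow>
          (lsc_polyconvex minors3 W \<longleftrightarrow>
             (\<exists>g :: (real^3) \<times> (real^3) \<times> real \<Rightarrow> ereal. lsc_convex g \<and> (\<forall>\<nu>. W (diag \<nu>) = g (m3 \<nu>)))) \<and>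
          ((\<exists>g :: (real^3) \<times> (real^3) \<times> real \<Rightarrow> ereal. lsc_convex g \<and> (\<forall>\<nu>. W (diag \<nu>) = g (m3 \<nu>))) \<longleftrightarrow>
             lsc_polyconvex m3 \<Phi>))"
proof (intro conjI allI impI, goal_cases)
  case (1 W \<Phi>)
  then show ?case
    using isotropic_lsc_polyconvex_minors2_iff[of W] by (simp add: lsc_polyconvex_def[of m2])
next
  case (2 W \<Phi>)
  then show ?case by (simp add: lsc_polyconvex_def)
next
  case (3 W \<Phi>)
  then show ?case
    using isotropic_lsc_polyconvex_minors3_iff[of W] by (simp add: lsc_polyconvex_def[of m3])
next
  case (4 W \<Phi>)
  then show ?case by (simp add: lsc_polyconvex_def)
qed

end
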